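(* Let $T$ be a non-empty finite set of positive integers with largest element $c$. Let $m$ be the smallest nonnegative integer such that for all integers $i\ge m$, \[ \tfrac12 i^2+\left(\tfrac32-c\right)i+\left(1+\tfrac12 c-\tfrac32 c^2\right) > 0, \] and let $d$ be the maximum of $2c+m-1$ and $\max_{-2c+2\le i\le c+m}\{f_T(i+c)-f_T(i)-f_T(i+1)+i+1\}$. Suppose $k$ is an integer with $k\ge\max\{2d-4c+2,\ 4c+d+1\}$ and \[ k > \max_{-2c+2\le i\le c+d+2}\{f_T(i-1+c)-f_T(i-1)-f_T(i)+i+2c-1\}. \] Then the $S$-LID sequence $(a_n)_{n\ge1}$ for $S=[k]\setminus(k-T)$ satisfies $a_{n+1}=a_n+a_{n-k}$ for all integers $n>k+c$.
   Context: $[k]=\{1,\dots,k\}$ and $k-T=\{k-t:t\in T\}$. For a set $S$ of positive integers, the $S$-legal index difference ($S$-LID) sequence $(a_n)_{n\ge 1}$ is defined recursively: for each positive integer $n$, $a_n$ is the smallest positive integer that cannot be written as $\sum_{\ell\in L} a_\ell$ for some set $L \subseteq \{1,\dots,n-1\}$ such that $|i-j|\notin S$ for all $i,j\in L$ (the empty sum is $0$). For each positive integer $k$ write $(a^{(k)}_n)$ for the $([k]\setminus(k-T))$-LID sequence. For each integer $i$, $f_T(i)$ denotes the integer such that $a^{(k)}_{k+i}=k+f_T(i)$ for every integer $k$ with $k>-i$ and $k\ge i+2c-1$ (this value is independent of such $k$; e.g. $f_T(i)=i$ for $i\le -c+1$). *)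

theory Defs
  imports Complex_Main
begin

definition legal :: "int set \<Rightarrow> int set \<Rightarrow> bool" where
  "legal S L \<longleftrightarrow> (\<forall>i\<in>L. \<forall>j\<in>L. \<bar>i - j\<bar> \<notin> S)"

text \<open>Only the values at indices \<open>n \<ge> 1\<close> are meaningful; for \<open>n \<le> 0\<close> the equation yields
  the value 1, which no other term refers to.\<close>

function lid :: "int set \<Rightarrow> int \<Rightarrow> int" where
  "lid S n = (LEAST x. x > 0 \<and>
     \<not> (\<exists>L\<in>{L. L \<subseteq> {1..n - 1} \<and> legal S L}. x = (\<Sum>l\<in>L. lid S l)))"
  by pat_completeness auto
termination
  by (relation "measure (\<lambda>(S, n). nat n)") auto

declare lid.simps [simp del]

definition lid_set :: "int set \<Rightarrow> int \<Rightarrow> int set" where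
  "lid_set T k = {1..k} - (\<lambda>t. k - t) ` T"

definition f_T :: "int set \<Rightarrow> int \<Rightarrow> int" where
  "f_T T i = (THE v. \<forall>k. k > - i \<and> k \<ge> i + 2 * Max T - 1 \<longrightarrow>
     lid (lid_set T k) (k + i) = k + v)"

end

theory Submission
  imports Defs
begin

text \<open>
  Write \<open>a\<close> for the sequence. Adding \<open>n\<close> to the legal sets inside \<open>{1..n - k - 1}\<close> always gives
  \<open>a (n + 1) \<ge> a n + a (n - k)\<close>, and equality can only fail if some legal set avoiding \<open>n\<close> sums to
  \<open>a n + a (n - k)\<close>. Distinct members of a legal set are at least \<open>k - c\<close> apart, so a legal sum
  inside \<open>{1..n}\<close> is at most \<open>B n = a n + a (n - (k - c)) + a (n - 2 * (k - c)) + \<dots>\<close>; hence it suffices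
  that \<open>slack q = a (q - 1) + a q - B (q - 1 + c)\<close> is positive for \<open>q = n - k\<close>. For
  \<open>q \<le> k - 2 * c + 1\<close> the slack is \<open>q - c\<close>, and up to \<open>q = k + c + 1\<close> the choice of \<open>d\<close> makes it at
  least \<open>2 * c + 2\<close>. Past that point it does not decrease: the recurrence turns its increment at \<open>p\<close>
  into \<open>slack (p - k)\<close> minus an error of at most \<open>2 * c + 2\<close> coming from the indices up to \<open>k + c\<close>,
  where the recurrence is not available.
\<close>

section \<open>Representable numbers and minimality of the terms\<close>

definition representable :: "int set \<Rightarrow> int \<Rightarrow> int \<Rightarrow> bool" where
  "representable S n x \<longleftrightarrow> (\<exists>L. L \<subseteq> {1..n} \<and> legal S L \<and> x = (\<Sum>l\<in>L. lid S l))"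

lemma representableI:
  "L \<subseteq> {1..n} \<Longrightarrow> legal S L \<Longrightarrow> x = (\<Sum>l\<in>L. lid S l) \<Longrightarrow> representable S n x"
  unfolding representable_def by blast

lemma representableE:
  assumes "representable S n x"
  obtains L where "L \<subseteq> {1..n}" "legal S L" "x = (\<Sum>l\<in>L. lid S l)"
  using assms unfolding representable_def by blast

text \<open>\<open>int\<close> is not well-ordered, so \<open>LEAST\<close> needs a lower bound;
  translating by \<open>b\<close> moves the question to \<open>nat\<close>.\<close>

lemma bounded_int_Least:
  fixes P :: "int \<Rightarrow> bool"
  assumes "P x" and bound: "\<And>y. P y \<Longrightarrow> b \<le> y"
  shows "P (LEAST y. P y)" and "P z \<Longrightarrow> (LEAST y. P y) \<le> z"
proof -
  define Q where "Q n = P (b + int n)" for n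
  have "Q (nat (x - b))" unfolding Q_def using assms(1) bound[of x] by simp
  then have Q: "Q (LEAST n. Q n)" by (rule LeastI)
  have le: "b + int (LEAST n. Q n) \<le> y" if "P y" for y
  proof -
    have "Q (nat (y - b))" unfolding Q_def using that bound[of y] by simp
    then have "(LEAST n. Q n) \<le> nat (y - b)" by (rule Least_le)
    then show ?thesis using bound[OF that] by linarith
  qed
  have "(LEAST y. P y) = b + int (LEAST n. Q n)"
    using Q le by (intro Least_equality) (auto simp: Q_def)
  then show "P (LEAST y. P y)" and "P z \<Longrightarrow> (LEAST y. P y) \<le> z"
    using Q le by (auto simp: Q_def)
qed

lemma finite_representable: "finite {x. representable S n x}"
proof (rule finite_subset)
  show "{x. representable S n x} \<subseteq> (\<lambda>L. \<Sum>l\<in>L. lid S l) ` Pow {1..n}"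
    unfolding representable_def by blast
qed simp

lemma lid_altdef: "lid S n = (LEAST x. x > 0 \<and> \<not> representable S (n - 1) x)"
  by (subst lid.simps) (simp add: representable_def Bex_def)

lemma lid_pos: "0 < lid S n"
  and lid_not_representable: "\<not> representable S (n - 1) (lid S n)"
  and lid_le: "0 < x \<Longrightarrow> \<not> representable S (n - 1) x \<Longrightarrow> lid S n \<le> x"
proof -
  define P where "P x \<longleftrightarrow> x > 0 \<and> \<not> representable S (n - 1) x" for x
  \<comment> \<open>Only finitely many subsets of \<open>{1..n - 1}\<close> exist, so some positive
    number is not representable and the \<open>LEAST\<close> is attained.\<close>
  have "\<not> {0<..} \<subseteq> {x. representable S (n - 1) x}"
    using finite_representable[of S "n - 1"] infinite_Ioi[of "0::int"] finite_subset by blast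
  then obtain x0 where "P x0" unfolding P_def by auto
  have bound: "P y \<Longrightarrow> 0 \<le> y" for y unfolding P_def by simp
  note bounded_int_Least[of P, OF \<open>P x0\<close> bound]
  moreover have "lid S n = (LEAST x. P x)" unfolding P_def by (rule lid_altdef)
  ultimately show "0 < lid S n" "\<not> representable S (n - 1) (lid S n)"
    "0 < x \<Longrightarrow> \<not> representable S (n - 1) x \<Longrightarrow> lid S n \<le> x"
    by (auto simp: P_def)
qed

lemma representable_below_lid:
  assumes "0 \<le> x" "x < lid S n"
  shows "representable S (n - 1) x"
proof (cases "x = 0")
  case True
  then show ?thesis by (auto intro!: representableI[of "{}"] simp: legal_def)
next
  case False
  then show ?thesis using assms lid_le[of x S n] by force
qed

lemma representable_mono: "representable S n x \<Longrightarrow> n \<le> n' \<Longrightarrow> representable S n' x"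
  by (elim representableE, rule representableI) auto

text \<open>Otherwise \<open>lid S n'\<close> would be representable by indices below
  \<open>n'\<close>: by \<open>{n}\<close> if the terms agree, and by minimality of
  \<open>lid S n\<close> if it is smaller.\<close>

lemma lid_strict_mono:
  assumes "0 \<notin> S" "1 \<le> n" "n < n'"
  shows "lid S n < lid S n'"
proof (rule ccontr)
  assume "\<not> lid S n < lid S n'"
  then consider "lid S n' = lid S n" | "lid S n' < lid S n" by linarith
  then have "representable S (n' - 1) (lid S n')"
  proof cases
    case 1
    show ?thesis unfolding 1
      by (rule representableI[of "{n}"]) (use assms in \<open>auto simp: legal_def\<close>)
  next
    case 2
    then have "representable S (n - 1) (lid S n')"
      using lid_pos[of S n'] by (intro representable_below_lid) auto
    then show ?thesis by (rule representable_mono) (use assms in auto)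
  qed
  then show False using lid_not_representable by blast
qed

text \<open>The guard on \<open>r\<close> secures termination; the function is applied with
  \<open>r = k - c\<close>, the least gap in a legal set.\<close>

function chain_sum :: "(int \<Rightarrow> int) \<Rightarrow> int \<Rightarrow> int \<Rightarrow> int" where
  "chain_sum a r n = (if n \<le> 0 \<or> r \<le> 0 then 0 else a n + chain_sum a r (n - r))"
  by pat_completeness auto
termination
  by (relation "measure (\<lambda>(a, r, n). nat n)") auto

declare chain_sum.simps [simp del]

lemma chain_sum_nonpos [simp]: "n \<le> 0 \<Longrightarrow> chain_sum a r n = 0"
  by (simp add: chain_sum.simps)

lemma chain_sum_pos: "0 < n \<Longrightarrow> 0 < r \<Longrightarrow> chain_sum a r n = a n + chain_sum a r (n - r)"
  by (subst chain_sum.simps) simp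

section \<open>Basic properties of the sequence for given \<open>T\<close> and
  \<open>k\<close>\<close>

text \<open>\<open>k\<close> is left free so that the locale can be interpreted at two values whose
  sequences are compared.\<close>

locale lid_sequence =
  fixes T :: "int set" and c k :: int
  assumes T_pos: "\<And>t. t \<in> T \<Longrightarrow> 0 < t"
    and T_le: "\<And>t. t \<in> T \<Longrightarrow> t \<le> c"
    and c_pos: "1 \<le> c"
begin

abbreviation S where "S \<equiv> lid_set T k"
abbreviation a where "a \<equiv> lid S"

lemma legal_gap:
  assumes "legal S L" "i \<in> L" "j \<in> L" "i < j"
  shows "j - i > k \<or> (\<exists>t\<in>T. j - i = k - t)"
proof -
  have "\<bar>j - i\<bar> \<notin> S" using assms unfolding legal_def by blast
  then show ?thesis using assms(4) unfolding lid_set_def by auto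
qed

lemma legal_gap_ge:
  assumes "legal S L" "i \<in> L" "j \<in> L" "i < j"
  shows "k - c \<le> j - i"
  using legal_gap[OF assms] T_le c_pos by force

lemma zero_notin_S: "0 \<notin> S"
  unfolding lid_set_def by auto

lemma legal_pair:
  assumes "i < j" "j - i > k \<or> (\<exists>t\<in>T. j - i = k - t)"
  shows "legal S {i, j}"
  using assms zero_notin_S unfolding legal_def lid_set_def by (auto simp: abs_minus_commute)

lemma a_strict_mono: "1 \<le> n \<Longrightarrow> n < n' \<Longrightarrow> a n < a n'"
  using lid_strict_mono zero_notin_S by blast

lemma a_mono: "1 \<le> n \<Longrightarrow> n \<le> n' \<Longrightarrow> a n \<le> a n'"
  using a_strict_mono[of n n'] by (cases "n = n'") auto

lemma legal_subsingleton:
  assumes "legal S L" "L \<subseteq> {1..n}" "n \<le> k - c" "x \<in> L"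
  shows "L = {x}"
proof -
  have "y = x" if "y \<in> L" for y
    using legal_gap_ge[OF assms(1) that assms(4)] legal_gap_ge[OF assms(1) assms(4) that]
      subsetD[OF assms(2) that] subsetD[OF assms(2,4)] assms(3)
    by (cases x y rule: linorder_cases) auto
  then show ?thesis using assms(4) by blast
qed

text \<open>Legal subsets of \<open>{1..k - c}\<close> have at most one element, so inductively the
  sums available before \<open>n\<close> are just \<open>0, ..., n - 1\<close>.\<close>

lemma a_small: "1 \<le> n \<Longrightarrow> n \<le> k - c + 1 \<Longrightarrow> a n = n"
proof (induction "nat n" arbitrary: n rule: less_induct)
  case less
  have IH: "a l = l" if "1 \<le> l" "l < n" for l
    using less that by simp
  have "\<not> representable S (n - 1) n"
  proof
    assume "representable S (n - 1) n"
    then obtain L where L: "L \<subseteq> {1..n - 1}" "legal S L" "n = (\<Sum>l\<in>L. a l)"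
      by (rule representableE)
    with less.prems have "L \<noteq> {}" by auto
    then obtain x where x: "x \<in> L" by blast
    then have "L = {x}" using legal_subsingleton[OF L(2,1)] less.prems by simp
    then have "n = x" using L x IH[of x] by auto
    then show False using L x by auto
  qed
  then have "a n \<le> n" using lid_le less.prems by simp
  moreover have "n \<le> a n"
  proof (cases "n = 1")
    case True
    then show ?thesis using lid_pos[of S n] by simp
  next
    case False
    then show ?thesis using a_strict_mono[of "n - 1" n] IH[of "n - 1"] less.prems by simp
  qed
  ultimately show ?case by simp
qed

lemma a_superadditive:
  assumes "k + 1 \<le> n" "0 \<le> k"
  shows "a n + a (n - k) \<le> a (n + 1)"
proof (rule ccontr)
  assume neg: "\<not> ?thesis"
  have "representable S n (a (n + 1))"
  proof (cases "a (n + 1) < a n")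
    case True
    then show ?thesis using a_strict_mono[of n "n + 1"] assms by simp
  next
    case False
    \<comment> \<open>The difference is nonnegative and below \<open>a (n - k)\<close>. Every index
      in the resulting set is more than \<open>k\<close> away from \<open>n\<close>, so
      \<open>n\<close> can be added.\<close>
    then have "representable S (n - k - 1) (a (n + 1) - a n)"
      using neg by (intro representable_below_lid) auto
    then obtain L where L: "L \<subseteq> {1..n - k - 1}" "legal S L" "a (n + 1) - a n = (\<Sum>l\<in>L. a l)"
      by (rule representableE)
    have fin: "finite L" using L(1) finite_subset by blast
    have n: "n \<notin> L" using L(1) assms by auto
    show ?thesis
    proof (rule representableI[of "insert n L"])
      show "insert n L \<subseteq> {1..n}" using L(1) assms by force
      have "\<bar>n - l\<bar> \<notin> S \<and> \<bar>l - n\<bar> \<notin> S" if "l \<in> L" for l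
        using subsetD[OF L(1) that] unfolding lid_set_def by auto
      then show "legal S (insert n L)"
        using L(2) zero_notin_S unfolding legal_def by auto
      show "a (n + 1) = (\<Sum>l\<in>insert n L. a l)" using L(3) fin n by simp
    qed
  qed
  then show False using lid_not_representable[of S "n + 1"] by simp
qed

section \<open>Independence of \<open>f_T\<close> from \<open>k\<close>\<close>

text \<open>A legal set \<open>{k' + j}\<close> or \<open>{l, k' + j}\<close> representing
  \<open>k' + y\<close> is carried to \<open>{k + j}\<close> or \<open>{l, k + j}\<close>, which
  would represent \<open>a (k + i)\<close> by earlier terms. The hypothesis \<open>same\<close>
  controls the top term, and \<open>l\<close> is small enough to be its own term.\<close>

lemma lid_shift_le:
  assumes k: "k > - i" "k \<ge> i + 2 * c - 1" and k': "k' > - i" "k' \<ge> i + 2 * c - 1"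
    and i: "i > - c + 1"
    and same: "\<And>j. - c < j \<Longrightarrow> j < i \<Longrightarrow> lid (lid_set T k') (k' + j) - k' = a (k + j) - k"
  shows "lid (lid_set T k') (k' + i) - k' \<le> a (k + i) - k"
proof -
  interpret k': lid_sequence T c k'
    by unfold_locales (use T_pos T_le c_pos in auto)
  define y where "y = a (k + i) - k"
  have "a (k - c + 1) < a (k + i)" using k i c_pos by (intro a_strict_mono) auto
  then have y: "- c + 1 < y" using a_small[of "k - c + 1"] k i by (simp add: y_def)
  have "\<not> representable k'.S (k' + i - 1) (k' + y)"
  proof
    assume "representable k'.S (k' + i - 1) (k' + y)"
    then obtain L where L: "L \<subseteq> {1..k' + i - 1}" "legal k'.S L" "k' + y = (\<Sum>l\<in>L. k'.a l)"
      by (rule representableE)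
    have fin: "finite L" using L(1) finite_subset by blast
    have "L \<noteq> {}" using L(3) y k' i by auto
    define j where "j = Max L - k'"
    have jL: "k' + j \<in> L" using Max_in[OF fin \<open>L \<noteq> {}\<close>] by (simp add: j_def)
    have below: "l < k' + j" if "l \<in> L - {k' + j}" for l
      using Max_ge[OF fin, of l] that by (simp add: j_def)
    have ji: "j < i" "1 \<le> k' + j" using jL L(1) by auto
    have rest: "L - {k' + j} \<subseteq> {1..j + c}"
      using k'.legal_gap_ge[OF L(2) _ jL] below L(1) by force
    have legal_rest: "legal k'.S (L - {k' + j})" using L(2) unfolding legal_def by blast
    have sum: "k' + y = k'.a (k' + j) + (\<Sum>l\<in>L - {k' + j}. k'.a l)"
      using L(3) sum.remove[OF fin jL, of "k'.a"] by simp
    have "representable S (k + i - 1) (k + y)"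
    proof (cases "L - {k' + j} = {}")
      case True
      have val: "y = k'.a (k' + j) - k'" using sum unfolding True by simp
      have j: "- c < j"
      proof (rule ccontr)
        assume "\<not> - c < j"
        then show False using k'.a_small[of "k' + j"] val ji y by simp
      qed
      show ?thesis
        by (rule representableI[of "{k + j}"])
          (use val same[OF j ji(1)] j ji k i zero_notin_S in \<open>auto simp: legal_def\<close>)
    next
      case False
      then obtain l where l: "l \<in> L - {k' + j}" by blast
      \<comment> \<open>From \<open>j < i\<close> and \<open>k' >= i + 2 * c - 1\<close> follows
        \<open>j + c <= k' - c\<close>, too short a range for two legal indices.\<close>
      have single: "L - {k' + j} = {l}"
        using k'.legal_subsingleton[OF legal_rest rest _ l] ji k' by simp
      have lb: "1 \<le> l" "l \<le> j + c" using rest l by auto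
      have j: "- c < j" using lb by simp
      \<comment> \<open>Both alternatives depend only on \<open>j - l\<close>, so they survive
        replacing \<open>k'\<close> by \<open>k\<close>.\<close>
      have gap: "k' + j - l > k' \<or> (\<exists>t\<in>T. k' + j - l = k' - t)"
        using k'.legal_gap[OF L(2) _ jL below[OF l]] l by blast
      have "l < k + j" using lb ji k i gap T_le by force
      have vals: "k'.a l = l" "a l = l"
        using k'.a_small[of l] a_small[of l] lb ji k k' by auto
      have "y = k'.a (k' + j) - k' + l" using sum single vals by simp
      then have "k + y = a (k + j) + a l" using same[OF j ji(1)] vals by simp
      moreover have "legal S {l, k + j}"
        using \<open>l < k + j\<close> gap by (intro legal_pair) auto
      ultimately show ?thesis
        using \<open>l < k + j\<close> lb ji by (intro representableI[of "{l, k + j}"]) auto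
    qed
    then show False using lid_not_representable[of S "k + i"] by (simp add: y_def)
  qed
  then have "k'.a (k' + i) \<le> k' + y"
    using y k' i by (intro lid_le) auto
  then show ?thesis by (simp add: y_def)
qed

end

text \<open>\<open>lid_shift_le\<close> is applied in both directions; the induction starts from
  \<open>i <= - c + 1\<close>, where both sides equal \<open>i\<close> by
  \<open>a_small\<close>.\<close>

lemma lid_shift_eq:
  fixes T :: "int set" and c :: int
  assumes T: "\<And>t. t \<in> T \<Longrightarrow> 0 < t" "\<And>t. t \<in> T \<Longrightarrow> t \<le> c" "1 \<le> c"
    and "k > - i" "k \<ge> i + 2 * c - 1" "k' > - i" "k' \<ge> i + 2 * c - 1"
  shows "lid (lid_set T k') (k' + i) - k' = lid (lid_set T k) (k + i) - k"
  using assms(4-)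
proof (induction "nat (i + c)" arbitrary: i rule: less_induct)
  case less
  interpret k: lid_sequence T c k by unfold_locales (use T in auto)
  interpret k': lid_sequence T c k' by unfold_locales (use T in auto)
  show ?case
  proof (cases "i > - c + 1")
    case False
    then show ?thesis using k.a_small[of "k + i"] k'.a_small[of "k' + i"] less.prems by simp
  next
    case True
    have same: "k'.a (k' + j) - k' = k.a (k + j) - k" if "- c < j" "j < i" for j
      using that less.prems T(3) True by (intro less.hyps) auto
    show ?thesis
      using k.lid_shift_le[OF less.prems True same] 
        k'.lid_shift_le[OF less.prems(3,4,1,2) True same[symmetric]] by simp
  qed
qed

context lid_sequence
begin

lemma f_T_eq:
  assumes "c = Max T" "k > - i" "k \<ge> i + 2 * c - 1"
  shows "f_T T i = a (k + i) - k"
  unfolding f_T_def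
proof (rule the_equality)
  have "lid (lid_set T k') (k' + i) - k' = a (k + i) - k"
    if "k' > - i" "k' \<ge> i + 2 * Max T - 1" for k'
    using that assms by (intro lid_shift_eq[OF T_pos T_le c_pos]) auto
  then show "\<forall>k'. k' > - i \<and> k' \<ge> i + 2 * Max T - 1 \<longrightarrow>
     lid (lid_set T k') (k' + i) = k' + (a (k + i) - k)"
    by force
next
  fix v
  assume "\<forall>k. k > - i \<and> k \<ge> i + 2 * Max T - 1 \<longrightarrow> lid (lid_set T k) (k + i) = k + v"
  then show "v = a (k + i) - k" using assms by simp
qed

end

section \<open>Upper bound for legal sums and the recurrence criterion\<close>

text \<open>The bound on \<open>k\<close> results from \<open>4 * c + d + 1 <= k\<close> and
  \<open>2 * c <= d\<close>.\<close>

locale lid_recurrence = lid_sequence +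
  assumes k_ge: "6 * c + 1 \<le> k"
begin

definition B where "B = chain_sum a (k - c)"

definition slack where "slack q = a (q - 1) + a q - B (q - 1 + c)"

lemma B_nonpos [simp]: "n \<le> 0 \<Longrightarrow> B n = 0"
  by (simp add: B_def)

lemma B_pos: "0 < n \<Longrightarrow> B n = a n + B (n - (k - c))"
  unfolding B_def using k_ge c_pos by (intro chain_sum_pos) auto

lemma B_small: "0 \<le> n \<Longrightarrow> n \<le> k - c \<Longrightarrow> B n = n"
  using B_pos[of n] a_small[of n] by (cases "n = 0") auto

lemma B_mono_nonneg: "0 \<le> B n \<and> (\<forall>n'\<le>n. B n' \<le> B n)"
proof (induction "nat n" arbitrary: n rule: less_induct)
  case less
  show ?case
  proof (cases "n \<le> 0")
    case True
    then show ?thesis by simp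
  next
    case False
    have IH: "0 \<le> B (n - (k - c))" "\<And>n'. n' \<le> n - (k - c) \<Longrightarrow> B n' \<le> B (n - (k - c))"
      using less[of "n - (k - c)"] False k_ge c_pos by auto
    have nn: "0 \<le> B n" using B_pos[of n] False IH lid_pos[of S n] by simp
    moreover have "B n' \<le> B n" if "n' \<le> n" for n'
    proof (cases "n' \<le> 0")
      case True
      then show ?thesis using nn by simp
    next
      case n': False
      then show ?thesis
        using B_pos[of n] B_pos[of n'] IH(2)[of "n' - (k - c)"] a_mono[of n' n] that by simp
    qed
    ultimately show ?thesis by blast
  qed
qed

text \<open>Removing the largest index \<open>j\<close> leaves a legal set inside
  \<open>{1..j - (k - c)}\<close>, matching the recursion of \<open>B\<close>.\<close>

lemma legal_sum_le: "L \<subseteq> {1..n} \<Longrightarrow> legal S L \<Longrightarrow> (\<Sum>l\<in>L. a l) \<le> B n"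
proof (induction "nat n" arbitrary: n L rule: less_induct)
  case less
  show ?case
  proof (cases "L = {}")
    case True
    then show ?thesis using B_mono_nonneg by simp
  next
    case False
    have fin: "finite L" using less.prems finite_subset by blast
    define j where "j = Max L"
    have jL: "j \<in> L" using fin False by (simp add: j_def)
    then have j: "1 \<le> j" "j \<le> n" using less.prems by auto
    have "L - {j} \<subseteq> {1..j - (k - c)}"
    proof
      fix l assume l: "l \<in> L - {j}"
      then have "l < j" using Max_ge[OF fin, of l] by (simp add: j_def)
      then show "l \<in> {1..j - (k - c)}"
        using legal_gap_ge[OF less.prems(2) _ jL, of l] l less.prems(1) by auto
    qed
    moreover have "legal S (L - {j})" using less.prems(2) unfolding legal_def by blast
    moreover have "nat (j - (k - c)) < nat n" using j k_ge c_pos by auto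
    ultimately have "(\<Sum>l\<in>L - {j}. a l) \<le> B (j - (k - c))"
      by (intro less.hyps)
    then have "(\<Sum>l\<in>L. a l) \<le> B j"
      using B_pos[of j] j sum.remove[OF fin jL, of a] by simp
    also have "\<dots> \<le> B n" using B_mono_nonneg j by blast
    finally show ?thesis .
  qed
qed

lemma a_Suc_le: "a (n + 1) \<le> B n + 1"
proof (rule lid_le)
  show "0 < B n + 1" using B_mono_nonneg[of n] by linarith
  show "\<not> representable S (n + 1 - 1) (B n + 1)"
    using legal_sum_le[of _ n] by (auto elim!: representableE) force
qed

lemma recurrence_of_slack:
  assumes n: "k + c < n" and slack: "1 \<le> slack (n - k)"
  shows "a (n + 1) = a n + a (n - k)"
proof (rule antisym)
  show "a n + a (n - k) \<le> a (n + 1)" using a_superadditive[of n] n c_pos k_ge by simp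
  have "\<not> representable S n (a n + a (n - k))"
  proof
    assume "representable S n (a n + a (n - k))"
    then obtain L where L: "L \<subseteq> {1..n}" "legal S L" "a n + a (n - k) = (\<Sum>l\<in>L. a l)"
      by (rule representableE)
    have fin: "finite L" using L(1) finite_subset by blast
    show False
    proof (cases "n \<in> L")
      case True
      have sum: "a (n - k) = (\<Sum>l\<in>L - {n}. a l)"
        using L(3) sum.remove[OF fin True, of a] by simp
      have "L - {n} \<subseteq> {1..n - k - 1}"
      proof
        fix l assume l: "l \<in> L - {n}"
        then have "l < n" "1 \<le> l" using L(1) by force+
        have "a l \<le> a (n - k)"
          unfolding sum using l fin lid_pos[of S] by (intro member_le_sum) (auto intro: less_imp_le)
        then have "l \<le> n - k"
          using a_strict_mono[of "n - k" l] n c_pos by (cases "l \<le> n - k") auto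
        \<comment> \<open>The gap \<open>k\<close> is not allowed: it does not exceed
          \<open>k\<close>, and \<open>k = k - t\<close> fails for \<open>t > 0\<close>.\<close>
        moreover have "l \<noteq> n - k"
          using legal_gap[OF L(2) _ True \<open>l < n\<close>] l T_pos by force
        ultimately show "l \<in> {1..n - k - 1}" using \<open>1 \<le> l\<close> by simp
      qed
      moreover have "legal S (L - {n})" using L(2) unfolding legal_def by blast
      ultimately have "representable S (n - k - 1) (a (n - k))"
        using sum by (rule representableI)
      then show False using lid_not_representable by blast
    next
      case False
      have "l \<in> {1..n - 1}" if "l \<in> L" for l
        using subsetD[OF L(1) that] that False by (cases "l = n") auto
      then have "L \<subseteq> {1..n - 1}" by blast
      then have "(\<Sum>l\<in>L. a l) \<le> B (n - 1)" using L(2) by (rule legal_sum_le)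
      also have "\<dots> = a (n - 1) + B (n - k - 1 + c)"
        using B_pos[of "n - 1"] n c_pos k_ge by (simp add: algebra_simps)
      \<comment> \<open>This is the positivity of \<open>slack\<close> at \<open>n - k\<close>;
        superadditivity at \<open>n - 1\<close> then absorbs the first two terms into
        \<open>a n\<close>.\<close>
      also have "\<dots> < a (n - 1) + a (n - 1 - k) + a (n - k)"
        using slack unfolding slack_def by (simp add: algebra_simps)
      also have "\<dots> \<le> a n + a (n - k)"
        using a_superadditive[of "n - 1"] n c_pos k_ge by simp
      finally show False using L(3) by simp
    qed
  qed
  then show "a (n + 1) \<le> a n + a (n - k)"
    using lid_pos[of S n] lid_pos[of S "n - k"] by (intro lid_le) auto
qed

section \<open>Increments of \<open>B\<close>\<close>

lemma B_step_small: "n < k - c \<Longrightarrow> B (n + 1) - B n \<le> 1"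
  using B_small[of n] B_small[of "n + 1"] k_ge c_pos by (cases "0 \<le> n") auto

text \<open>For \<open>n >= k - c\<close> the first term of \<open>B\<close> grows by at most
  \<open>n - (k - c) + 1 <= 2 * c + 1\<close>, by \<open>a_Suc_le\<close>, and the remainder by at
  most 1.\<close>

lemma B_step_le:
  assumes "n \<le> k + c"
  shows "B (n + 1) - B n \<le> 2 * c + 2"
proof (cases "n < k - c")
  case True
  then show ?thesis using B_step_small[of n] c_pos by simp
next
  case False
  have "B n = a n + B (n - (k - c))" "B (n + 1) = a (n + 1) + B (n - (k - c) + 1)"
    using B_pos[of n] B_pos[of "n + 1"] False k_ge c_pos by (auto simp: algebra_simps)
  moreover have "B (n - (k - c) + 1) - B (n - (k - c)) \<le> 1"
    using assms k_ge c_pos by (intro B_step_small) auto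
  moreover have "B (n - (k - c)) = n - (k - c)"
    using assms k_ge c_pos False by (intro B_small) auto
  ultimately show ?thesis using a_Suc_le[of n] assms by linarith
qed

lemma B_step_recurrence:
  assumes "k + c < n" and "a (n + 1) = a n + a (n - k)"
  shows "B (n + 1) - B n = a (n - k) + (B (n - k + c + 1) - B (n - k + c))"
  using assms B_pos[of n] B_pos[of "n + 1"] k_ge c_pos by (simp add: algebra_simps)

text \<open>Iterating \<open>B_step_recurrence\<close> collects exactly the terms of
  \<open>B (n - k)\<close>. It stops once the index is at most \<open>k + c\<close>, so the error of
  \<open>B_step_le\<close> is paid only once.\<close>

lemma B_step_bound:
  assumes "\<And>n'. k + c < n' \<Longrightarrow> n' \<le> n \<Longrightarrow> a (n' + 1) = a n' + a (n' - k)"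
  shows "B (n + 1) - B n \<le> B (n - k) + 2 * c + 2"
  using assms
proof (induction "nat n" arbitrary: n rule: less_induct)
  case less
  show ?case
  proof (cases "n \<le> k + c")
    case True
    then show ?thesis using B_step_le[of n] B_mono_nonneg[of "n - k"] by linarith
  next
    case False
    have "B (n - k + c + 1) - B (n - k + c) \<le> B (n - k + c - k) + 2 * c + 2"
      using False k_ge c_pos less.prems by (intro less.hyps) auto
    moreover have "B (n - k) = a (n - k) + B (n - k + c - k)"
      using B_pos[of "n - k"] False c_pos by (simp add: algebra_simps)
    ultimately show ?thesis using B_step_recurrence[of n] less.prems[of n] False by simp
  qed
qed

section \<open>Positivity of the slack\<close>

text \<open>The upper bound on \<open>q\<close> keeps \<open>q - 1 + c\<close> within
  \<open>k - c\<close>, where \<open>B\<close> is the identity.\<close>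

lemma slack_small:
  assumes "c < q" "q \<le> k - 2 * c + 1"
  shows "slack q = q - c"
  using assms a_small[of "q - 1"] a_small[of q] B_small[of "q - 1 + c"] c_pos k_ge
  unfolding slack_def by simp

lemma slack_step:
  assumes p: "k + c < p" and rec: "\<And>q. c < q \<Longrightarrow> q \<le> p \<Longrightarrow> 1 \<le> slack q"
    and large: "3 * c + 2 \<le> p - k \<Longrightarrow> 2 * c + 2 \<le> slack (p - k)"
  shows "slack p \<le> slack (p + 1)"
proof -
  define r where "r = p - k"
  \<comment> \<open>For these \<open>n\<close> the index \<open>n - k\<close> is at most
    \<open>p\<close>, where \<open>rec\<close> already gives positive slack.\<close>
  have recurrence: "a (n + 1) = a n + a (n - k)" if "k + c < n" "n \<le> p + k" for n
    using that by (intro recurrence_of_slack rec) auto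
  have "B (p + c) - B (p - 1 + c) = a (r - 1 + c) + (B (r + 2 * c) - B (r - 1 + 2 * c))"
    using B_step_recurrence[of "p - 1 + c"] recurrence[of "p - 1 + c"] p k_ge c_pos
    by (simp add: r_def algebra_simps)
  moreover have "a (p - 1) + a (r - 1) \<le> a p" "a p + a r \<le> a (p + 1)"
    using a_superadditive[of "p - 1"] a_superadditive[of p] p k_ge c_pos
    by (auto simp: r_def algebra_simps)
  moreover have "a (r - 1 + c) + (B (r + 2 * c) - B (r - 1 + 2 * c)) \<le> a (r - 1) + a r"
  proof (cases "r - 1 + 2 * c < k - c")
    case True
    then have "a (r - 1) = r - 1" "a r = r" "a (r - 1 + c) = r - 1 + c"
      using p c_pos by (auto simp: r_def intro!: a_small)
    then show ?thesis using B_step_small[OF True] p by (simp add: r_def algebra_simps)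
  next
    case False
    \<comment> \<open>Here \<open>r >= k - 3 * c + 1 >= 3 * c + 2\<close> by \<open>k_ge\<close>,
      the threshold in \<open>large\<close>.\<close>
    then have "2 * c + 2 \<le> slack r" using large k_ge by (simp add: r_def)
    moreover have "B (r - 1 + 2 * c + 1) - B (r - 1 + 2 * c) \<le> B (r - 1 + 2 * c - k) + 2 * c + 2"
      using k_ge c_pos by (intro B_step_bound recurrence) (auto simp: r_def)
    moreover have "B (r - 1 + c) = a (r - 1 + c) + B (r - 1 + 2 * c - k)"
      using B_pos[of "r - 1 + c"] p c_pos by (simp add: r_def algebra_simps)
    ultimately show ?thesis unfolding slack_def by (simp add: algebra_simps)
  qed
  ultimately show ?thesis unfolding slack_def by (simp add: algebra_simps)
qed

text \<open>The threshold \<open>3 * c + 2\<close> is where the initial value \<open>q - c\<close>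
  reaches \<open>2 * c + 2\<close>. The base range must include \<open>k + c + 1\<close>, the first
  point from which \<open>slack_step\<close> applies.\<close>

lemma slack_ge:
  assumes base: "\<And>q. k - 2 * c + 2 \<le> q \<Longrightarrow> q \<le> k + c + 1 \<Longrightarrow> 2 * c + 2 \<le> slack q"
    and "c < q"
  shows "1 \<le> slack q \<and> (3 * c + 2 \<le> q \<longrightarrow> 2 * c + 2 \<le> slack q)"
  using assms(2)
proof (induction "nat q" arbitrary: q rule: less_induct)
  case less
  have IH: "1 \<le> slack q' \<and> (3 * c + 2 \<le> q' \<longrightarrow> 2 * c + 2 \<le> slack q')" if "c < q'" "q' < q" for q'
    using less.hyps[of q'] that c_pos by simp
  consider "q \<le> k - 2 * c + 1" | "k - 2 * c + 2 \<le> q" "q \<le> k + c + 1" | "k + c + 1 < q"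
    by linarith
  then show ?case
  proof cases
    case 1
    then show ?thesis using slack_small[of q] less.prems by simp
  next
    case 2
    then show ?thesis using base[of q] c_pos by simp
  next
    case 3
    have "slack (q - 1) \<le> slack (q - 1 + 1)"
      using 3 IH k_ge c_pos by (intro slack_step) auto
    moreover have "2 * c + 2 \<le> slack (q - 1)"
      using IH[of "q - 1"] 3 k_ge c_pos by simp
    ultimately show ?thesis using c_pos by simp
  qed
qed

end

section \<open>The constants \<open>m\<close> and \<open>d\<close> and the base range\<close>

text \<open>This makes the \<open>LEAST\<close> defining \<open>m\<close> attained. Substituting
  \<open>y = 4 * x + z\<close> leaves only nonnegative coefficients.\<close>

lemma quadratic_eventually_pos:
  fixes c :: int
  assumes "1 \<le> c" "4 * c \<le> i"
  shows "1/2 * (real_of_int i)\<^sup>2 + (3/2 - real_of_int c) * real_of_int i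
    + (1 + 1/2 * real_of_int c - 3/2 * (real_of_int c)\<^sup>2) > 0"
proof -
  define x y where "x = real_of_int c" and "y = real_of_int i"
  have "1 \<le> x" "4 * x \<le> y" using assms by (auto simp: x_def y_def)
  then obtain z where z: "y = 4 * x + z" "0 \<le> z"
    by (metis diff_ge_0_iff_ge le_add_diff_inverse)
  have "1/2 * y\<^sup>2 + (3/2 - x) * y + (1 + 1/2 * x - 3/2 * x\<^sup>2)
      = 5/2 * x\<^sup>2 + 3 * (x * z) + 1/2 * z\<^sup>2 + 13/2 * x + 3/2 * z + 1"
    by (simp add: z field_simps power2_eq_square)
  also have "\<dots> > 0" using \<open>1 \<le> x\<close> z(2) by (intro add_nonneg_pos add_nonneg_nonneg) auto
  finally show ?thesis by (simp add: x_def y_def)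
qed

theorem theorem3p10:
  fixes T :: "int set" and c m d k :: int
  assumes "finite T" and "T \<noteq> {}" and "\<forall>t\<in>T. t > 0"
    and "c = Max T"
    and "m = (LEAST m. m \<ge> 0 \<and> (\<forall>i\<ge>m.
           1/2 * (real_of_int i)\<^sup>2 + (3/2 - real_of_int c) * real_of_int i
             + (1 + 1/2 * real_of_int c - 3/2 * (real_of_int c)\<^sup>2) > 0))"
    and "d = max (2 * c + m - 1)
           (MAX i\<in>{- 2 * c + 2..c + m}. f_T T (i + c) - f_T T i - f_T T (i + 1) + i + 1)"
    and "k \<ge> max (2 * d - 4 * c + 2) (4 * c + d + 1)"
    and "k > (MAX i\<in>{- 2 * c + 2..c + d + 2}.
           f_T T (i - 1 + c) - f_T T (i - 1) - f_T T i + i + 2 * c - 1)"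
  shows "\<forall>n > k + c. lid (lid_set T k) (n + 1) = lid (lid_set T k) n + lid (lid_set T k) (n - k)"
proof -
  have "c \<in> T" using assms(1,2,4) by simp
  then have c: "1 \<le> c" using assms(3) by force
  define P where "P m \<longleftrightarrow> m \<ge> 0 \<and> (\<forall>i\<ge>m.
     1/2 * (real_of_int i)\<^sup>2 + (3/2 - real_of_int c) * real_of_int i
       + (1 + 1/2 * real_of_int c - 3/2 * (real_of_int c)\<^sup>2) > 0)" for m :: int
  have "P (4 * c)" unfolding P_def using c quadratic_eventually_pos by simp
  moreover have "0 \<le> m" if "P m" for m using that by (simp add: P_def)
  ultimately have "P (LEAST m. P m)" by (rule bounded_int_Least(1))
  then have "P m" using assms(5) by (simp add: P_def)
  \<comment> \<open>Excluding \<open>m = 0\<close> yields \<open>d >= 2 * c\<close>, hence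
    \<open>k >= 6 * c + 1\<close>.\<close>
  have "\<not> P 0"
  proof
    assume "P 0"
    then have "3 * (real_of_int c)\<^sup>2 < 2 + real_of_int c" by (auto simp: P_def dest!: spec[of _ 0])
    moreover have "real_of_int c * 1 \<le> (real_of_int c)\<^sup>2" "1 \<le> real_of_int c"
      using c unfolding power2_eq_square by (auto intro!: mult_left_mono)
    ultimately show False by linarith
  qed
  then have m: "1 \<le> m" using \<open>P m\<close> by (cases "m = 0") (auto simp: P_def)
  have d_ge: "2 * c + m - 1 \<le> d" using assms(6) by simp
  have d: "f_T T (i + c) - f_T T i - f_T T (i + 1) + i + 1 \<le> d" if "i \<in> {- 2 * c + 2..c + m}" for i
    unfolding assms(6) using that by (auto intro!: max.coboundedI2 Max_ge)
  have k: "4 * c + d + 1 \<le> k" using assms(7) by simp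
  interpret lid_recurrence T c k
    using assms(1,3,4) c d_ge m k by unfold_locales auto
  have "2 * c + 2 \<le> slack q" if q: "k - 2 * c + 2 \<le> q" "q \<le> k + c + 1" for q
  proof (cases "q = k - 2 * c + 2")
    \<comment> \<open>Now \<open>q - k - 1 = - 2 * c + 1\<close> lies just below the range of the
      maximum in \<open>d\<close>, so the slack is computed directly.\<close>
    case True
    then have "B (q - 1 + c) = q - 1 + c + 1"
      using B_pos[of "q - 1 + c"] a_small[of "q - 1 + c"] B_small[of 1] k_ge c by simp
    moreover have "a (q - 1) = q - 1" "a q = q"
      using True k_ge c by (auto intro!: a_small)
    ultimately show ?thesis using True k_ge c unfolding slack_def by simp
  next
    case False
    \<comment> \<open>With this shift \<open>a (q - 1)\<close>, \<open>a q\<close> and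
      \<open>a (q - 1 + c)\<close> become the values of \<open>f_T\<close> at \<open>i\<close>,
      \<open>i + 1\<close> and \<open>i + c\<close>.\<close>
    define i where "i = q - k - 1"
    have i: "- 2 * c + 2 \<le> i" "i \<le> c" using q False by (auto simp: i_def)
    have f: "f_T T j = a (k + j) - k" if "- 2 * c + 2 \<le> j" "j \<le> 2 * c" for j
      using that k_ge c assms(4) by (intro f_T_eq) auto
    have "f_T T (i + c) = a (q - 1 + c) - k" "f_T T i = a (q - 1) - k" "f_T T (i + 1) = a q - k"
      using f[of "i + c"] f[of i] f[of "i + 1"] i c by (auto simp: i_def algebra_simps)
    moreover have "B (q - 1 + c) = a (q - 1 + c) + (i + 2 * c)"
      using B_pos[of "q - 1 + c"] B_small[of "i + 2 * c"] i k_ge c by (simp add: i_def algebra_simps)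
    \<comment> \<open>The maximum in \<open>d\<close> gives
      \<open>slack q >= k + 1 - d - 2 * c\<close>, and \<open>k >= 4 * c + d + 1\<close> makes this
      at least \<open>2 * c + 2\<close>.\<close>
    ultimately show ?thesis
      using d[of i] i m k unfolding slack_def by simp
  qed
  then show ?thesis
    using recurrence_of_slack slack_ge by simp
qed

end
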